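(* Let $L\subseteq\mathbb{R}^n$ be an $n$-dimensional lattice. Then $$c_2(\mathbb{R}^n/L)\ \ge\ \frac{\pi\,\lambda(L^* )\,\mu(L)}{\sqrt{n}}.$$
   Context: An $n$-dimensional lattice $L\subseteq\mathbb{R}^n$ is the set of all integral linear combinations of a basis of $\mathbb{R}^n$; $|x|=\sqrt{x^{\mathsf T}x}$. The flat torus $\mathbb{R}^n/L$ has the metric $d_{\mathbb{R}^n/L}(x,y)=\min_{v\in L}|x-y-v|$. The dual lattice is $L^*=\{u\in\mathbb{R}^n: u^{\mathsf T}v\in\mathbb{Z}\text{ for all }v\in L\}$. The Voronoi cell is $V(L)=\{x\in\mathbb{R}^n: |x|\le|x-v|\text{ for all }v\in L\}$. The covering radius is $\mu(L)=\max\{|x|:x\in V(L)\}$, and $\lambda(L)=\min\{|v|:v\in L\setminus\{0\}\}$ is the length of a shortest nonzero vector of $L$. A Euclidean embedding of $\mathbb{R}^n/L$ is an injective function $\varphi:\mathbb{R}^n/L\to H$ into some (complex) Hilbert space $H$. Its distortion is $$\mathrm{dist}(\varphi)=\sup_{x\ne y}\frac{\|\varphi(x)-\varphi(y)\|}{d_{\mathbb{R}^n/L}(x,y)}\cdot\sup_{x\neq y}\frac{d_{\mathbb{R}^n/L}(x,y)}{\|\varphi(x)-\varphi(y)\|},$$ with suprema over distinct $x,y\in\mathbb{R}^n/L$. The least (Euclidean) distortion is $c_2(\mathbb{R}^n/L)=\inf\{\mathrm{dist}(\varphi)\}$ over all Euclidean embeddings $\varphi$ of $\mathbb{R}^n/L$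 into Hilbert spaces. *)

theory Defs
  imports "HOL-Analysis.Analysis"
begin

definition is_lattice :: "(real ^ 'n) set \<Rightarrow> bool" where
  "is_lattice L \<longleftrightarrow>
     (\<exists>B. independent B \<and> span B = UNIV \<and>
          L = range (\<lambda>c :: real ^ 'n \<Rightarrow> int. \<Sum>b\<in>B. of_int (c b) *\<^sub>R b))"

definition dual_lattice :: "(real ^ 'n) set \<Rightarrow> (real ^ 'n) set" where
  "dual_lattice L = {u. \<forall>v\<in>L. u \<bullet> v \<in> \<int>}"

definition voronoi_cell :: "(real ^ 'n) set \<Rightarrow> (real ^ 'n) set" where
  "voronoi_cell L = {x. \<forall>v\<in>L. norm x \<le> norm (x - v)}"

text \<open>
  The supremum and the infima below are taken over infinite sets of reals. For a lattice
  they are attained, so they are the maximum and minima of the usual definitions.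
\<close>

definition covering_radius :: "(real ^ 'n) set \<Rightarrow> real" where
  "covering_radius L = (SUP x\<in>voronoi_cell L. norm x)"

definition shortest_length :: "(real ^ 'n) set \<Rightarrow> real" where
  "shortest_length L = (INF v\<in>L - {0}. norm v)"

definition lattice_rel :: "(real ^ 'n) set \<Rightarrow> ((real ^ 'n) \<times> (real ^ 'n)) set" where
  "lattice_rel L = {(x, y). x - y \<in> L}"

definition torus :: "(real ^ 'n) set \<Rightarrow> (real ^ 'n) set set" where
  "torus L = UNIV // lattice_rel L"

text \<open>
  Points of the torus are cosets, so the distance ranges over all representatives;
  \<open>torus_dist_coset\<close> below shows that the choice of representatives is immaterial.
\<close>

definition torus_dist :: "(real ^ 'n) set \<Rightarrow> (real ^ 'n) set \<Rightarrow> (real ^ 'n) set \<Rightarrow> real" where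
  "torus_dist L X Y = Inf {norm (x - y - v) | x y v. x \<in> X \<and> y \<in> Y \<and> v \<in> L}"

lemma is_lattice_zero:
  assumes "is_lattice L"
  shows "0 \<in> L"
proof -
  obtain B where L: "L = range (\<lambda>c :: real ^ 'a \<Rightarrow> int. \<Sum>b\<in>B. of_int (c b) *\<^sub>R b)"
    using assms unfolding is_lattice_def by blast
  show ?thesis
    unfolding L by (rule range_eqI[of _ _ "\<lambda>_. 0"]) simp
qed

lemma is_lattice_diff:
  assumes "is_lattice L" "v \<in> L" "w \<in> L"
  shows "v - w \<in> L"
proof -
  obtain B where L: "L = range (\<lambda>c :: real ^ 'a \<Rightarrow> int. \<Sum>b\<in>B. of_int (c b) *\<^sub>R b)"
    using assms(1) unfolding is_lattice_def by blast
  obtain c d where "v = (\<Sum>b\<in>B. of_int (c b) *\<^sub>R b)" "w = (\<Sum>b\<in>B. of_int (d b) *\<^sub>R b)"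
    using assms(2,3) unfolding L by blast
  then have "v - w = (\<Sum>b\<in>B. of_int (c b - d b) *\<^sub>R b)"
    by (simp add: sum_subtractf scaleR_left_diff_distrib)
  then show ?thesis
    unfolding L by (intro range_eqI[of _ _ "\<lambda>b. c b - d b"]) simp
qed

lemma is_lattice_add:
  assumes "is_lattice L" "v \<in> L" "w \<in> L"
  shows "v + w \<in> L"
  using is_lattice_diff[OF assms(1,2) is_lattice_diff[OF assms(1) is_lattice_zero[OF assms(1)] assms(3)]]
  by simp

lemma equiv_lattice_rel:
  assumes "is_lattice L"
  shows "equiv UNIV (lattice_rel L)"
proof (rule equivI)
  show "refl (lattice_rel L)"
    using is_lattice_zero[OF assms] by (auto simp: refl_on_def lattice_rel_def)
  show "sym (lattice_rel L)"
  proof (rule symI)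
    fix x y assume "(x, y) \<in> lattice_rel L"
    then show "(y, x) \<in> lattice_rel L"
      using is_lattice_diff[OF assms is_lattice_zero[OF assms], of "x - y"]
      by (simp add: lattice_rel_def)
  qed
  show "trans (lattice_rel L)"
  proof (rule transI)
    fix x y z assume "(x, y) \<in> lattice_rel L" "(y, z) \<in> lattice_rel L"
    then show "(x, z) \<in> lattice_rel L"
      using is_lattice_add[OF assms, of "x - y" "y - z"]
      by (simp add: lattice_rel_def)
  qed
qed auto

lemma torus_dist_coset:
  assumes "is_lattice L"
  shows "torus_dist L (lattice_rel L `` {x}) (lattice_rel L `` {y}) = (INF v\<in>L. norm (x - y - v))"
proof -
  have "{norm (x' - y' - v) | x' y' v.
           x' \<in> lattice_rel L `` {x} \<and> y' \<in> lattice_rel L `` {y} \<and> v \<in> L}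
        = (\<lambda>v. norm (x - y - v)) ` L" (is "?A = ?B")
  proof
    show "?A \<subseteq> ?B"
    proof
      fix r assume "r \<in> ?A"
      then obtain x' y' v where *: "r = norm (x' - y' - v)" "x - x' \<in> L" "y - y' \<in> L" "v \<in> L"
        by (auto simp: lattice_rel_def)
      have "(x - x') - (y - y') + v \<in> L"
        by (intro is_lattice_add is_lattice_diff assms *)
      moreover have "r = norm (x - y - ((x - x') - (y - y') + v))"
        by (simp add: *(1) algebra_simps)
      ultimately show "r \<in> ?B" by blast
    qed
    show "?B \<subseteq> ?A"
    proof
      fix r assume "r \<in> ?B"
      then obtain v where "v \<in> L" "r = norm (x - y - v)" by blast
      moreover have "x \<in> lattice_rel L `` {x}" "y \<in> lattice_rel L `` {y}"
        using is_lattice_zero[OF assms] by (simp_all add: lattice_rel_def)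
      ultimately show "r \<in> ?A" by blast
    qed
  qed
  then show ?thesis
    by (simp add: torus_dist_def)
qed

text \<open>
  Real scalar multiplication, norm and completeness come from \<^class>\<open>banach\<close>; the axioms
  \<open>scaleR_scaleC\<close> and \<open>cinner_self\<close> tie them to the complex structure. Positive definiteness
  of \<open>cinner\<close> is contained in \<open>cinner_self\<close>.
\<close>

class complex_hilbert = banach +
  fixes scaleC :: "complex \<Rightarrow> 'a \<Rightarrow> 'a"  (infixr \<open>*\<^sub>C\<close> 75)
    and cinner :: "'a \<Rightarrow> 'a \<Rightarrow> complex"
  assumes scaleC_add_right: "a *\<^sub>C (x + y) = a *\<^sub>C x + a *\<^sub>C y"
    and scaleC_add_left: "(a + b) *\<^sub>C x = a *\<^sub>C x + b *\<^sub>C x"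
    and scaleC_scaleC: "a *\<^sub>C (b *\<^sub>C x) = (a * b) *\<^sub>C x"
    and scaleR_scaleC: "r *\<^sub>R x = complex_of_real r *\<^sub>C x"
    and cinner_commute: "cinner x y = cnj (cinner y x)"
    and cinner_add_left: "cinner (x + y) z = cinner x z + cinner y z"
    and cinner_scaleC_left: "cinner (a *\<^sub>C x) y = a * cinner x y"
    and cinner_self: "cinner x x = complex_of_real ((norm x)\<^sup>2)"

instantiation complex :: complex_hilbert
begin

definition scaleC_complex :: "complex \<Rightarrow> complex \<Rightarrow> complex" where
  "scaleC_complex a x = a * x"

definition cinner_complex :: "complex \<Rightarrow> complex \<Rightarrow> complex" where
  "cinner_complex x y = x * cnj y"

instance
proof
  fix x :: complex
  show "cinner x x = complex_of_real ((norm x)\<^sup>2)"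
    unfolding cinner_complex_def by (rule complex_norm_square[symmetric])
qed (simp_all add: scaleC_complex_def cinner_complex_def distrib_left distrib_right scaleR_conv_of_real)

end

definition distortion :: "(real ^ 'n) set \<Rightarrow> ((real ^ 'n) set \<Rightarrow> 'h::complex_hilbert) \<Rightarrow> ereal" where
  "distortion L \<phi> =
     (SUP (x, y) \<in> {(x, y). x \<in> torus L \<and> y \<in> torus L \<and> x \<noteq> y}.
        ereal (norm (\<phi> x - \<phi> y) / torus_dist L x y)) *
     (SUP (x, y) \<in> {(x, y). x \<in> torus L \<and> y \<in> torus L \<and> x \<noteq> y}.
        ereal (torus_dist L x y / norm (\<phi> x - \<phi> y)))"

text \<open>
  HOL cannot quantify over types inside a term, so the Hilbert space is an argument here. A
  lower bound on \<open>least_distortion TYPE('h) L\<close> for a type variable \<open>'h\<close> is the same as a lower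
  bound on the infimum over the embeddings into all Hilbert spaces.
\<close>

definition least_distortion :: "'h::complex_hilbert itself \<Rightarrow> (real ^ 'n) set \<Rightarrow> ereal" where
  "least_distortion _ L = Inf {distortion L \<phi> | \<phi> :: (real ^ 'n) set \<Rightarrow> 'h. inj_on \<phi> (torus L)}"

end

theory Submission
  imports Defs "HOL-Real_Asymp.Real_Asymp"
begin

text \<open>
  The bound is a Poincare inequality on the torus. Let \<open>\<phi>\<close> be an embedding with Lipschitz
  constant \<open>s1\<close> whose inverse has Lipschitz constant \<open>s2\<close>, and write \<open>l\<close> for the length of a
  shortest nonzero dual lattice vector. Translation by \<open>y\<close> multiplies the Fourier coefficient of
  \<open>\<phi>\<close> at a dual lattice vector \<open>u\<close> by a number on the unit circle, so the mean square of
  \<open>\<phi> (x + y) - \<phi> x\<close> over \<open>x\<close> is at most \<open>4 * V\<close>, where \<open>V\<close> is the sum of the squared norms of the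
  coefficients with \<open>u \<noteq> 0\<close>. For \<open>y\<close> in the Voronoi cell it is also at least
  \<open>(norm y / s2)\<^sup>2\<close>. Translations by \<open>t\<close> times the \<open>n\<close> standard unit vectors, for small \<open>t\<close>, have
  total mean square displacement about \<open>t\<^sup>2\<close> times the sum over \<open>u\<close> of
  \<open>4 * pi\<^sup>2 * (norm u)\<^sup>2\<close> times the squared norm of the coefficient, hence at least about
  \<open>4 * pi\<^sup>2 * l\<^sup>2 * t\<^sup>2 * V\<close>; by the Lipschitz condition it is at most \<open>n * s1\<^sup>2 * t\<^sup>2\<close>.
  Eliminating \<open>V\<close> gives \<open>pi\<^sup>2 * l\<^sup>2 * (norm y)\<^sup>2 \<le> n * (s1 * s2)\<^sup>2\<close>.

  To avoid integration of Hilbert space valued functions, the torus is replaced by the finite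
  group of points whose lattice coordinates are multiples of \<open>1 / N\<close>, with \<open>N\<close> odd. There the
  Fourier analysis is a finite computation (\<open>shift_energy\<close>, \<open>poincare_inequality\<close>,
  \<open>character_orthogonal\<close>). The unit vectors need not be displacements of the grid; lattice vectors
  pointing nearly in their directions are used instead, scaled by \<open>1 / N\<close>. That the lower bound for
  their total displacement holds for all frequencies at once when \<open>N\<close> is large is
  \<open>spectral_gap\<close>. Letting \<open>N\<close> tend to infinity gives \<open>displacement_bound\<close>, and letting the
  directions approach the unit vectors gives \<open>dist_lattice_bound\<close>.
\<close>

section \<open>Finite Fourier analysis in a Hilbert space\<close>

lemma cinner_scaleC_right: "cinner (y :: 'h::complex_hilbert) (a *\<^sub>C x) = cnj a * cinner y x"
  by (metis cinner_commute cinner_scaleC_left complex_cnj_mult)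

lemma norm_scaleC: "norm (a *\<^sub>C (x :: 'h::complex_hilbert)) = cmod a * norm x"
proof -
  have "complex_of_real ((norm (a *\<^sub>C x))\<^sup>2) = complex_of_real ((cmod a * norm x)\<^sup>2)"
    unfolding cinner_self[symmetric] cinner_scaleC_left cinner_scaleC_right
    by (simp only: cinner_self power_mult_distrib of_real_mult complex_norm_square mult_ac)
  then have "(norm (a *\<^sub>C x))\<^sup>2 = (cmod a * norm x)\<^sup>2"
    by (simp only: of_real_eq_iff)
  then show ?thesis
    by (simp add: power2_eq_iff_nonneg)
qed

lemma cinner_zero_left: "cinner 0 (y :: 'h::complex_hilbert) = 0"
  using cinner_add_left[of 0 0 y] by simp

lemma cinner_sum_left: "cinner (\<Sum>i\<in>I. f i) (y :: 'h::complex_hilbert) = (\<Sum>i\<in>I. cinner (f i) y)"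
  by (induction I rule: infinite_finite_induct) (auto simp: cinner_zero_left cinner_add_left)

lemma cinner_sum_right: "cinner (y :: 'h::complex_hilbert) (\<Sum>i\<in>I. f i) = (\<Sum>i\<in>I. cinner y (f i))"
  by (subst cinner_commute) (simp add: cinner_sum_left flip: cinner_commute)

lemma scaleC_zero: "a *\<^sub>C (0 :: 'h::complex_hilbert) = 0"
  using scaleC_add_right[of a 0 "0::'h"] by simp

lemma scaleC_sum: "a *\<^sub>C (\<Sum>i\<in>I. f i) = (\<Sum>i\<in>I. a *\<^sub>C (f i :: 'h::complex_hilbert))"
  by (induction I rule: infinite_finite_induct) (auto simp: scaleC_zero scaleC_add_right)

lemma scaleC_diff_right: "a *\<^sub>C (x - y) = a *\<^sub>C x - a *\<^sub>C (y :: 'h::complex_hilbert)"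
  using scaleC_add_right[of a "x - y" y] by simp

lemma scaleC_diff_left: "(a - b) *\<^sub>C x = a *\<^sub>C x - b *\<^sub>C (x :: 'h::complex_hilbert)"
  using scaleC_add_left[of "a - b" b x] by (simp add: algebra_simps)

lemma scaleC_one: "1 *\<^sub>C x = (x :: 'h::complex_hilbert)"
  using scaleR_scaleC[of 1 x] by simp

definition fourier_coeff ::
  "'i set \<Rightarrow> ('k \<Rightarrow> 'i \<Rightarrow> complex) \<Rightarrow> ('i \<Rightarrow> 'h::complex_hilbert) \<Rightarrow> 'k \<Rightarrow> 'h" where
  "fourier_coeff I \<psi> f k = (\<Sum>m\<in>I. cnj (\<psi> k m) *\<^sub>C f m)"

text \<open>
  The characters enter only through one orthogonality relation on a finite set \<open>I\<close>. The sum over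
  \<open>k\<close> is taken at two fixed points of \<open>I\<close>, so this is completeness of the character system, and
  it makes the double sum of inner products collapse to its diagonal.
\<close>

lemma parseval_identity:
  fixes f :: "'i \<Rightarrow> 'h::complex_hilbert"
  assumes "finite I"
    and orth: "\<And>m m'. m \<in> I \<Longrightarrow> m' \<in> I \<Longrightarrow>
      (\<Sum>k\<in>K. cnj (\<psi> k m) * \<psi> k m') = (if m = m' then complex_of_real c else 0)"
  shows "(\<Sum>k\<in>K. (norm (fourier_coeff I \<psi> f k))\<^sup>2) = c * (\<Sum>m\<in>I. (norm (f m))\<^sup>2)"
proof -
  have "complex_of_real (\<Sum>k\<in>K. (norm (fourier_coeff I \<psi> f k))\<^sup>2)
      = (\<Sum>k\<in>K. cinner (fourier_coeff I \<psi> f k) (fourier_coeff I \<psi> f k))"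
    by (simp only: of_real_sum cinner_self)
  also have "\<dots> = (\<Sum>k\<in>K. \<Sum>m\<in>I. \<Sum>m'\<in>I. (cnj (\<psi> k m) * \<psi> k m') * cinner (f m) (f m'))"
    unfolding fourier_coeff_def cinner_sum_left cinner_sum_right cinner_scaleC_left cinner_scaleC_right
    unfolding sum_distrib_left
    by (rule sum.cong[OF refl], subst sum.swap) (simp add: mult.assoc mult.left_commute)
  also have "\<dots> = (\<Sum>m\<in>I. \<Sum>m'\<in>I. (\<Sum>k\<in>K. cnj (\<psi> k m) * \<psi> k m') * cinner (f m) (f m'))"
    unfolding sum_distrib_right
    by (subst sum.swap, rule sum.cong[OF refl], subst sum.swap) simp
  also have "\<dots> = (\<Sum>m\<in>I. \<Sum>m'\<in>I. if m = m' then complex_of_real c * cinner (f m) (f m') else 0)"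
    by (intro sum.cong refl) (simp add: orth)
  also have "\<dots> = complex_of_real (c * (\<Sum>m\<in>I. (norm (f m))\<^sup>2))"
    using assms(1) by (simp add: cinner_self sum_distrib_left)
  finally show ?thesis
    by (simp only: of_real_eq_iff)
qed

text \<open>
  A translation multiplies each character by a unimodular constant, so the difference operator
  \<open>f \<circ> \<sigma> - f\<close> acts on Fourier coefficients as multiplication by \<open>z k - 1\<close>.
\<close>

lemma shift_energy:
  fixes f :: "'i \<Rightarrow> 'h::complex_hilbert"
  assumes "finite I"
    and orth: "\<And>m m'. m \<in> I \<Longrightarrow> m' \<in> I \<Longrightarrow>
      (\<Sum>k\<in>K. cnj (\<psi> k m) * \<psi> k m') = (if m = m' then complex_of_real c else 0)"
    and bij: "bij_betw \<sigma> I I"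
    and char: "\<And>k m. k \<in> K \<Longrightarrow> m \<in> I \<Longrightarrow> \<psi> k (\<sigma> m) = z k * \<psi> k m"
    and unit: "\<And>k. k \<in> K \<Longrightarrow> cmod (z k) = 1"
  shows "c * (\<Sum>m\<in>I. (norm (f (\<sigma> m) - f m))\<^sup>2)
       = (\<Sum>k\<in>K. (cmod (z k - 1))\<^sup>2 * (norm (fourier_coeff I \<psi> f k))\<^sup>2)"
proof -
  have "fourier_coeff I \<psi> (\<lambda>m. f (\<sigma> m) - f m) k = (z k - 1) *\<^sub>C fourier_coeff I \<psi> f k"
    if k: "k \<in> K" for k
  proof -
    have "cnj (\<psi> k m) = z k * cnj (\<psi> k (\<sigma> m))" if "m \<in> I" for m
    proof -
      have "z k * cnj (z k) = 1"
        using unit[OF k] by (simp flip: complex_norm_square)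
      then show ?thesis
        using char[OF k that] by (metis complex_cnj_mult mult.assoc mult_1)
    qed
    then have "(\<Sum>m\<in>I. cnj (\<psi> k m) *\<^sub>C f (\<sigma> m)) = (\<Sum>m\<in>I. z k *\<^sub>C (cnj (\<psi> k (\<sigma> m)) *\<^sub>C f (\<sigma> m)))"
      by (intro sum.cong) (simp_all add: scaleC_scaleC)
    also have "\<dots> = (\<Sum>m\<in>I. z k *\<^sub>C (cnj (\<psi> k m) *\<^sub>C f m))"
      by (rule sum.reindex_bij_betw[OF bij])
    also have "\<dots> = z k *\<^sub>C fourier_coeff I \<psi> f k"
      by (simp add: fourier_coeff_def scaleC_sum)
    finally show ?thesis
      by (simp add: fourier_coeff_def scaleC_diff_right scaleC_diff_left sum_subtractf scaleC_one)
  qed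
  then show ?thesis
    using parseval_identity[OF assms(1) orth, where f = "\<lambda>m. f (\<sigma> m) - f m"]
    by (simp add: norm_scaleC power_mult_distrib)
qed

text \<open>
  A single displacement costs at most four times the energy outside the trivial frequency \<open>k0\<close>,
  because \<open>cmod (z - 1) \<le> 2\<close> on the unit circle. The weighted energy of the displacements
  \<open>g j\<close> is at least \<open>\<gamma>\<close> times that same energy, by the gap hypothesis. Hence any displacement is
  controlled by the chosen ones.
\<close>

lemma poincare_inequality:
  fixes f :: "'i \<Rightarrow> 'h::complex_hilbert"
  assumes "finite I" and c: "c > 0"
    and orth: "\<And>m m'. m \<in> I \<Longrightarrow> m' \<in> I \<Longrightarrow>
      (\<Sum>k\<in>K. cnj (\<psi> k m) * \<psi> k m') = (if m = m' then complex_of_real c else 0)"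
    and bij: "\<And>g. bij_betw (\<sigma> g) I I"
    and char: "\<And>g k m. k \<in> K \<Longrightarrow> m \<in> I \<Longrightarrow> \<psi> k (\<sigma> g m) = z g k * \<psi> k m"
    and unit: "\<And>g k. k \<in> K \<Longrightarrow> cmod (z g k) = 1"
    and trivial: "\<And>g. z g k0 = 1"
    and \<gamma>: "\<gamma> \<ge> 0"
    and gap: "\<And>k. k \<in> K - {k0} \<Longrightarrow> \<gamma> \<le> (\<Sum>j\<in>J. w j * (cmod (z (g j) k - 1))\<^sup>2)"
  shows "\<gamma> * (\<Sum>m\<in>I. (norm (f (\<sigma> y m) - f m))\<^sup>2)
     \<le> 4 * (\<Sum>j\<in>J. w j * (\<Sum>m\<in>I. (norm (f (\<sigma> (g j) m) - f m))\<^sup>2))"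
proof -
  let ?F = "\<lambda>k. (norm (fourier_coeff I \<psi> f k))\<^sup>2"
  note energy = shift_energy[OF assms(1) orth bij char unit, where f = f]
  have four: "(cmod (z y k - 1))\<^sup>2 \<le> 4" if "k \<in> K" for k
  proof -
    have "cmod (z y k - 1) \<le> 2"
      using norm_triangle_ineq4[of "z y k" 1] unit[OF that] by simp
    then show ?thesis
      using power_mono[of "cmod (z y k - 1)" 2 2] by simp
  qed
  have "c * (\<gamma> * (\<Sum>m\<in>I. (norm (f (\<sigma> y m) - f m))\<^sup>2)) = (\<Sum>k\<in>K. \<gamma> * ((cmod (z y k - 1))\<^sup>2 * ?F k))"
    by (subst mult.left_commute, subst energy) (simp_all add: sum_distrib_left)
  also have "\<dots> \<le> (\<Sum>k\<in>K. 4 * ((\<Sum>j\<in>J. w j * (cmod (z (g j) k - 1))\<^sup>2) * ?F k))"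
  proof (rule sum_mono)
    fix k assume k: "k \<in> K"
    show "\<gamma> * ((cmod (z y k - 1))\<^sup>2 * ?F k) \<le> 4 * ((\<Sum>j\<in>J. w j * (cmod (z (g j) k - 1))\<^sup>2) * ?F k)"
    proof (cases "k = k0")
      case True
      then show ?thesis by (simp add: trivial)
    next
      case False
      have "\<gamma> * (cmod (z y k - 1))\<^sup>2 \<le> (\<Sum>j\<in>J. w j * (cmod (z (g j) k - 1))\<^sup>2) * 4"
        using gap[of k] k False four[OF k] \<gamma> by (intro mult_mono) auto
      from mult_right_mono[OF this, of "?F k"] show ?thesis
        by (simp add: algebra_simps)
    qed
  qed
  also have "\<dots> = 4 * (\<Sum>j\<in>J. w j * (\<Sum>k\<in>K. (cmod (z (g j) k - 1))\<^sup>2 * ?F k))"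
    unfolding sum_distrib_right sum_distrib_left
    by (subst sum.swap) (simp add: mult.assoc)
  also have "\<dots> = 4 * (\<Sum>j\<in>J. w j * (c * (\<Sum>m\<in>I. (norm (f (\<sigma> (g j) m) - f m))\<^sup>2)))"
    by (simp add: energy)
  also have "\<dots> = c * (4 * (\<Sum>j\<in>J. w j * (\<Sum>m\<in>I. (norm (f (\<sigma> (g j) m) - f m))\<^sup>2)))"
    by (simp add: sum_distrib_left mult_ac)
  finally show ?thesis
    using c by simp
qed

section \<open>Characters of the grid and cyclic shifts\<close>

lemma cis_eq_1_iff: "cis (2 * pi * x) = 1 \<longleftrightarrow> x \<in> \<int>"
proof
  assume "cis (2 * pi * x) = 1"
  then have "cos (2 * pi * x) = 1"
    by (simp add: complex_eq_iff)
  then obtain n :: int where "2 * pi * x = n * 2 * pi"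
    by (auto simp: cos_one_2pi_int)
  then show "x \<in> \<int>"
    by simp
qed simp

lemma cmod_cis_minus_1: "(cmod (cis (2 * t) - 1))\<^sup>2 = 4 * (sin t)\<^sup>2"
proof -
  have "(cmod (cis (2 * t) - 1))\<^sup>2 = (cos (2 * t) - 1)\<^sup>2 + (sin (2 * t))\<^sup>2"
    by (simp add: cmod_power2)
  also have "\<dots> = 2 - 2 * cos (2 * t)"
    unfolding sin_squared_eq by (simp add: algebra_simps power2_eq_square)
  finally show ?thesis
    by (simp add: cos_double_sin)
qed

lemma sum_roots_of_unity:
  fixes h d :: int
  assumes h: "h \<ge> 0" and d: "\<bar>d\<bar> < 2 * h + 1"
  shows "(\<Sum>k\<in>{-h..h}. cis (2 * pi * (of_int (k * d) / of_int (2 * h + 1))))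
       = (if d = 0 then of_int (2 * h + 1) else 0)"
proof (cases "d = 0")
  case True
  then show ?thesis using h by simp
next
  case False
  let ?N = "2 * h + 1"
  define q where "q = cis (2 * pi * (of_int d / of_int ?N))"
  have "of_int d / of_int ?N \<notin> (\<int> :: real set)"
  proof
    assume "of_int d / of_int ?N \<in> (\<int> :: real set)"
    then obtain e :: int where "of_int d / (of_int ?N :: real) = of_int e"
      by (elim Ints_cases)
    then have "(of_int d :: real) = of_int (e * ?N)"
      using h by (simp add: field_simps)
    then have "d = e * ?N"
      by (simp only: of_int_eq_iff)
    then have "?N dvd d" by simp
    then show False
      using False d h dvd_imp_le_int[of d ?N] by auto
  qed
  then have q1: "q \<noteq> 1"
    unfolding q_def cis_eq_1_iff .
  have qN: "q ^ nat ?N = 1"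
  proof -
    have "real (nat ?N) * (2 * pi * (of_int d / of_int ?N)) = 2 * pi * of_int d"
      using h by (simp add: field_simps)
    then show ?thesis
      unfolding q_def Complex.DeMoivre by simp
  qed
  have "(\<Sum>k\<in>{-h..h}. cis (2 * pi * (of_int (k * d) / of_int ?N)))
      = (\<Sum>j<nat ?N. cis (- (2 * pi * (of_int (h * d) / of_int ?N))) * q ^ j)"
  proof (rule sum.reindex_bij_witness[of _ "\<lambda>j. int j - h" "\<lambda>k. nat (k + h)"])
    fix k assume "k \<in> {-h..h}"
    then have "real (nat (k + h)) = of_int (k + h)"
      by simp
    then show "cis (- (2 * pi * (of_int (h * d) / of_int ?N))) * q ^ nat (k + h) =
        cis (2 * pi * (of_int (k * d) / of_int ?N))"
      unfolding q_def Complex.DeMoivre cis_mult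
      by (simp add: field_simps add_divide_distrib)
  qed (use h in auto)
  also have "\<dots> = 0"
    using geometric_sum[OF q1, of "nat ?N"] qN by (simp flip: sum_distrib_left)
  finally show ?thesis using False by simp
qed

definition character :: "'b set \<Rightarrow> int \<Rightarrow> ('b \<Rightarrow> int) \<Rightarrow> ('b \<Rightarrow> int) \<Rightarrow> complex" where
  "character B N k m = cis (2 * pi * (of_int (\<Sum>b\<in>B. k b * m b) / of_int N))"

lemma character_add: "character B N k (\<lambda>b. m b + m' b) = character B N k m * character B N k m'"
  by (simp add: character_def cis_mult sum.distrib algebra_simps add_divide_distrib)

lemma cis_sum: "finite B \<Longrightarrow> cis (\<Sum>b\<in>B. f b) = (\<Prod>b\<in>B. cis (f b))"
  by (induction B rule: finite_induct) (auto simp flip: cis_mult)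

text \<open>
  The modulus is odd so that the frequencies have the representatives \<open>-h..h\<close>, symmetric about 0;
  \<open>spectral_gap\<close> relies on these being the smallest ones. The sum factors over \<open>B\<close> into sums of
  roots of unity.
\<close>

lemma character_orthogonal:
  assumes B: "finite B" and h: "h \<ge> 0"
    and m: "m \<in> PiE B (\<lambda>_. {0..<2 * h + 1})" and m': "m' \<in> PiE B (\<lambda>_. {0..<2 * h + 1})"
  shows "(\<Sum>k\<in>PiE B (\<lambda>_. {-h..h}). cnj (character B (2 * h + 1) k m) * character B (2 * h + 1) k m')
    = (if m = m' then complex_of_real (of_int (2 * h + 1) ^ card B) else 0)"
proof -
  let ?N = "2 * h + 1"
  have "cnj (character B ?N k m) * character B ?N k m'
      = (\<Prod>b\<in>B. cis (2 * pi * (of_int (k b * (m' b - m b)) / of_int ?N)))" for k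
    unfolding character_def cis_sum[OF B, symmetric] cis_cnj cis_mult
    by (simp add: sum_distrib_left sum_divide_distrib algebra_simps diff_divide_distrib sum_subtractf)
  then have "(\<Sum>k\<in>PiE B (\<lambda>_. {-h..h}). cnj (character B ?N k m) * character B ?N k m')
      = (\<Prod>b\<in>B. \<Sum>k\<in>{-h..h}. cis (2 * pi * (of_int (k * (m' b - m b)) / of_int ?N)))"
    using B by (simp add: prod_sum_PiE)
  also have "\<dots> = (\<Prod>b\<in>B. if m' b - m b = 0 then of_int ?N else 0)"
  proof (intro prod.cong refl sum_roots_of_unity h)
    fix b assume "b \<in> B"
    then have "m b \<in> {0..<?N}" "m' b \<in> {0..<?N}"
      using m m' by (auto simp: PiE_iff)
    then show "\<bar>m' b - m b\<bar> < ?N"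
      by auto
  qed
  also have "\<dots> = (if m = m' then complex_of_real (of_int ?N ^ card B) else 0)"
  proof (cases "m = m'")
    case False
    then obtain b where "b \<in> B" "m' b \<noteq> m b"
      using PiE_ext[OF m m'] by metis
    then have "\<exists>b\<in>B. (if m' b - m b = 0 then of_int ?N else 0 :: complex) = 0"
      by (intro bexI[of _ b]) auto
    then show ?thesis
      using False B by (simp only: prod_zero if_False)
  qed simp
  finally show ?thesis .
qed

definition shift_mod :: "'b set \<Rightarrow> int \<Rightarrow> ('b \<Rightarrow> int) \<Rightarrow> ('b \<Rightarrow> int) \<Rightarrow> 'b \<Rightarrow> int" where
  "shift_mod B N g m = (\<lambda>b\<in>B. (m b + g b) mod N)"

lemma bij_betw_shift_mod:
  assumes "N > 0"
  shows "bij_betw (shift_mod B N g) (PiE B (\<lambda>_. {0..<N})) (PiE B (\<lambda>_. {0..<N}))"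
proof (rule bij_betw_byWitness[of _ "shift_mod B N (\<lambda>b. - g b)"])
  have inv: "shift_mod B N (\<lambda>b. - g b) (shift_mod B N g m) = m"
    if "m \<in> PiE B (\<lambda>_. {0..<N})" for m g
  proof
    fix b
    show "shift_mod B N (\<lambda>b. - g b) (shift_mod B N g m) b = m b"
      using that by (auto simp: shift_mod_def PiE_iff extensional_def mod_diff_left_eq)
  qed
  show "\<forall>m\<in>PiE B (\<lambda>_. {0..<N}). shift_mod B N (\<lambda>b. - g b) (shift_mod B N g m) = m"
    using inv by blast
  show "\<forall>m\<in>PiE B (\<lambda>_. {0..<N}). shift_mod B N g (shift_mod B N (\<lambda>b. - g b) m) = m"
    using inv[of _ "\<lambda>b. - g b"] by simp
qed (use assms in \<open>auto simp: shift_mod_def\<close>)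

lemma character_shift_mod:
  assumes "N > 0"
  shows "character B N k (shift_mod B N g m) = character B N k g * character B N k m"
proof -
  let ?q = "\<lambda>b. - ((m b + g b) div N)"
  have "(\<Sum>b\<in>B. k b * shift_mod B N g m b) = (\<Sum>b\<in>B. k b * (g b + m b + N * ?q b))"
    by (intro sum.cong) (simp_all add: shift_mod_def add.commute flip: minus_div_mult_eq_mod mult.commute)
  then have "character B N k (shift_mod B N g m) = character B N k (\<lambda>b. g b + m b + N * ?q b)"
    by (simp add: character_def)
  moreover have "character B N k (\<lambda>b. N * ?q b) = 1"
  proof -
    have "(\<Sum>b\<in>B. k b * (N * ?q b)) = N * (\<Sum>b\<in>B. k b * ?q b)"
      by (simp add: sum_distrib_left mult.left_commute)
    moreover have "cis (2 * pi * (of_int (N * s) / of_int N)) = 1" for s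
      using assms by simp
    ultimately show ?thesis
      unfolding character_def by (simp only:)
  qed
  ultimately show ?thesis
    by (simp only: character_add mult_1_right)
qed

section \<open>Elementary estimates for the sine\<close>

text \<open>
  A cheap substitute for Jordan's inequality with constant \<open>2 / pi\<close>; the cubic Taylor bound
  suffices since \<open>pi / 2 < 8 / 5\<close> has square below 3.
\<close>

lemma half_le_sin:
  fixes x :: real
  assumes "0 \<le> x" "x \<le> pi / 2"
  shows "x / 2 \<le> sin x"
proof -
  have "\<bar>sin x - (\<Sum>m<3. sin_coeff m * x ^ m)\<bar> \<le> inverse (fact 3) * \<bar>x\<bar> ^ 3"
    by (rule Maclaurin_sin_bound)
  moreover have "(\<Sum>m<3. sin_coeff m * x ^ m) = x"
    by (simp add: sin_coeff_def eval_nat_numeral)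
  ultimately have "\<bar>sin x - x\<bar> \<le> x ^ 3 / 6"
    using assms by (simp add: fact_numeral)
  then have "x - x ^ 3 / 6 \<le> sin x" by linarith
  moreover have "x ^ 3 / 6 \<le> x / 2"
  proof -
    have "x\<^sup>2 \<le> (32 / 20)\<^sup>2"
      using assms pi_less_4 pi_approx by (intro power_mono) auto
    then have "x\<^sup>2 * x \<le> 3 * x"
      using assms by (intro mult_right_mono) (auto simp: power2_eq_square)
    then show ?thesis
      by (simp add: power3_eq_cube power2_eq_square)
  qed
  ultimately show ?thesis by linarith
qed

lemma sin_squared_ge:
  fixes x :: real
  assumes "\<bar>x\<bar> \<le> 1 / 2"
  shows "x\<^sup>2 \<le> (sin (pi * x))\<^sup>2"
proof -
  have "\<bar>x\<bar> * 2 \<le> pi * \<bar>x\<bar>"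
    using mult_right_mono[OF pi_ge_two, of "\<bar>x\<bar>"] by (simp add: mult.commute)
  also have "\<dots> / 2 \<le> sin (pi * \<bar>x\<bar>)"
    using assms by (intro half_le_sin) (auto simp: field_simps)
  finally have "\<bar>x\<bar> \<le> sin (pi * \<bar>x\<bar>)" by simp
  then have "\<bar>x\<bar>\<^sup>2 \<le> (sin (pi * \<bar>x\<bar>))\<^sup>2"
    by (intro power_mono) auto
  then show ?thesis
    by (simp add: abs_if split: if_splits)
qed

lemma tendsto_scaled_sin:
  fixes s :: real
  assumes "filterlim N at_top F"
  shows "((\<lambda>h. N h * sin (pi * s / N h)) \<longlongrightarrow> pi * s) F"
proof (cases "s = 0")
  case False
  have "((\<lambda>x. sin x / x) \<longlongrightarrow> (1 :: real)) (at 0)"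
    using DERIV_sin[of "0::real"] by (simp add: has_field_derivative_iff)
  moreover have "filterlim (\<lambda>h. pi * s / N h) (at 0) F"
  proof -
    have "((\<lambda>h. pi * s / N h) \<longlongrightarrow> 0) F"
      using assms by (intro tendsto_divide_0[OF tendsto_const] filterlim_at_top_imp_at_infinity)
    moreover have "eventually (\<lambda>h. pi * s / N h \<noteq> 0) F"
      using assms[unfolded filterlim_at_top_dense, rule_format, of 0] False by (auto elim!: eventually_mono)
    ultimately show ?thesis
      by (simp add: filterlim_at)
  qed
  ultimately have "((\<lambda>h. sin (pi * s / N h) / (pi * s / N h)) \<longlongrightarrow> 1) F"
    by (rule filterlim_compose)
  from tendsto_mult_left[OF this, of "pi * s"] show ?thesis
    using False by (simp add: mult.commute)
qed simp

section \<open>A lattice with a chosen basis\<close>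

locale lattice_basis =
  fixes B :: "(real ^ 'n) set"
  assumes indep: "independent B" and span: "span B = UNIV"
begin

definition comb :: "(real ^ 'n \<Rightarrow> int) \<Rightarrow> real ^ 'n" where
  "comb c = (\<Sum>b\<in>B. of_int (c b) *\<^sub>R b)"

abbreviation L :: "(real ^ 'n) set" where
  "L \<equiv> range comb"

lemma finite_basis: "finite B"
  using indep by (rule independent_imp_finite)

lemma is_lattice_L: "is_lattice L"
  unfolding is_lattice_def comb_def using indep span by blast

lemma comb_add: "comb (\<lambda>b. c b + d b) = comb c + comb d"
  by (simp add: comb_def sum.distrib scaleR_left_distrib)

lemma comb_mult: "comb (\<lambda>b. a * c b) = of_int a *\<^sub>R comb c"
  by (simp add: comb_def scaleR_sum_right)

lemma comb_cong: "(\<And>b. b \<in> B \<Longrightarrow> c b = d b) \<Longrightarrow> comb c = comb d"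
  by (simp add: comb_def)

lemma comb_unit: "b \<in> B \<Longrightarrow> comb (\<lambda>b'. if b' = b then 1 else 0) = b"
  using finite_basis by (simp add: comb_def if_distrib[of "\<lambda>x. of_int x *\<^sub>R _"] cong: if_cong)

lemma ex_dual_vector: "\<exists>u. \<forall>b\<in>B. u \<bullet> b = k b"
proof -
  obtain g where g: "linear g" "\<forall>b\<in>B. g b = k b"
    using linear_independent_extend[OF indep, of k] by blast
  have "adjoint g 1 \<bullet> b = k b" if "b \<in> B" for b
    using adjoint_works[OF g(1), of b 1] g(2) that by (simp add: inner_commute)
  then show ?thesis by blast
qed

lemma inner_comb: "(\<And>b. b \<in> B \<Longrightarrow> u \<bullet> b = of_int (k b)) \<Longrightarrow> u \<bullet> comb c = of_int (\<Sum>b\<in>B. k b * c b)"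
  by (simp add: comb_def inner_sum_right mult.commute)

text \<open>
  The coordinates of a lattice vector are its inner products with the dual basis, hence bounded
  integers when the vector is bounded.
\<close>

lemma finite_lattice_ball: "finite {v \<in> L. norm v \<le> R}"
proof -
  have "\<forall>b. \<exists>u. \<forall>b'\<in>B. u \<bullet> b' = of_int (if b' = b then 1 else 0)"
    using ex_dual_vector[of "\<lambda>b'. of_int (if b' = _ then 1 else 0)"] by blast
  then obtain u where u: "\<And>b b'. b' \<in> B \<Longrightarrow> u b \<bullet> b' = of_int (if b' = b then 1 else 0)"
    by metis
  let ?r = "\<lambda>b. \<lceil>norm (u b) * R\<rceil>"
  have "{v \<in> L. norm v \<le> R} \<subseteq> comb ` PiE B (\<lambda>b. {- ?r b..?r b})"
  proof
    fix v assume v: "v \<in> {v \<in> L. norm v \<le> R}"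
    then obtain c where c: "v = comb c" by blast
    have "\<bar>c b\<bar> \<le> ?r b" if "b \<in> B" for b
    proof -
      have "of_int (c b) = u b \<bullet> v"
        unfolding c using that finite_basis u
        by (subst inner_comb[OF u]) (auto simp: if_distrib[of "\<lambda>x. x * _"] cong: if_cong)
      then have "\<bar>of_int (c b)\<bar> \<le> norm (u b) * norm v"
        by (simp add: Cauchy_Schwarz_ineq2)
      also have "\<dots> \<le> norm (u b) * R"
        using v by (intro mult_left_mono) auto
      finally show ?thesis by linarith
    qed
    then have "restrict c B \<in> PiE B (\<lambda>b. {- ?r b..?r b})"
      by (auto simp: abs_le_iff) (use neg_le_iff_le in fastforce)+
    moreover have "v = comb (restrict c B)"
      unfolding c by (rule comb_cong) simp
    ultimately show "v \<in> comb ` PiE B (\<lambda>b. {- ?r b..?r b})" by blast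
  qed
  moreover have "finite (comb ` PiE B (\<lambda>b. {- ?r b..?r b}))"
    using finite_basis by (intro finite_imageI finite_PiE) auto
  ultimately show ?thesis by (rule finite_subset)
qed

text \<open>
  Rounding the coordinates of \<open>M *\<^sub>R x\<close> down moves the point by at most the sum of the lengths of
  the basis vectors, whatever \<open>M\<close> is.
\<close>

lemma ex_comb_near: "\<exists>C\<ge>0. \<forall>M>0. \<exists>c. norm (comb c /\<^sub>R M - x) \<le> C / M"
proof (intro exI[of _ "\<Sum>b\<in>B. norm b"] conjI allI impI)
  fix M :: real assume M: "M > 0"
  obtain a where a: "x = (\<Sum>b\<in>B. a b *\<^sub>R b)"
    using span span_finite[OF finite_basis] by blast
  let ?c = "\<lambda>b. \<lfloor>M * a b\<rfloor>"
  have "comb ?c - M *\<^sub>R x = (\<Sum>b\<in>B. (of_int (?c b) - M * a b) *\<^sub>R b)"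
    by (simp add: a comb_def scaleR_sum_right sum_subtractf scaleR_left_diff_distrib)
  also have "norm \<dots> \<le> (\<Sum>b\<in>B. norm b)"
  proof (rule order_trans[OF norm_sum sum_mono])
    fix b
    have "\<bar>of_int (?c b) - M * a b\<bar> \<le> 1" by linarith
    then show "norm ((of_int (?c b) - M * a b) *\<^sub>R b) \<le> norm b"
      by (simp add: mult_left_le_one_le)
  qed
  finally have "norm (comb ?c - M *\<^sub>R x) / M \<le> (\<Sum>b\<in>B. norm b) / M"
    using M by (simp add: divide_right_mono)
  moreover have "comb ?c /\<^sub>R M - x = (comb ?c - M *\<^sub>R x) /\<^sub>R M"
    using M by (simp add: algebra_simps)
  ultimately show "\<exists>c. norm (comb c /\<^sub>R M - x) \<le> (\<Sum>b\<in>B. norm b) / M"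
    using M by (intro exI[of _ ?c]) (simp add: divide_inverse mult.commute)
qed (simp add: sum_nonneg)

text \<open>
  The torus distance between two cosets as a function of the difference of their representatives.
\<close>

definition dist_lattice :: "real ^ 'n \<Rightarrow> real" where
  "dist_lattice x = (INF v\<in>L. norm (x - v))"

lemma dist_lattice_le: "v \<in> L \<Longrightarrow> dist_lattice x \<le> norm (x - v)"
  unfolding dist_lattice_def by (rule cINF_lower) (auto intro: bdd_belowI[of _ 0])

lemma dist_lattice_greatest: "(\<And>v. v \<in> L \<Longrightarrow> r \<le> norm (x - v)) \<Longrightarrow> r \<le> dist_lattice x"
  unfolding dist_lattice_def by (rule cINF_greatest) auto

lemma dist_lattice_le_norm: "dist_lattice x \<le> norm x"
  using dist_lattice_le[OF is_lattice_zero[OF is_lattice_L]] by simp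

lemma dist_lattice_lipschitz: "dist_lattice x \<le> dist_lattice y + norm (y - x)"
proof -
  have "dist_lattice x - norm (y - x) \<le> dist_lattice y"
  proof (rule dist_lattice_greatest)
    fix v assume "v \<in> L"
    then have "dist_lattice x \<le> norm ((y - v) - (y - x))"
      using dist_lattice_le[of v x] by simp
    also have "\<dots> \<le> norm (y - v) + norm (y - x)"
      by (rule norm_triangle_ineq4)
    finally show "dist_lattice x - norm (y - x) \<le> norm (y - v)" by simp
  qed
  then show ?thesis by simp
qed

text \<open>
  Only finitely many lattice vectors can be within distance 1 of \<open>x\<close>. Positivity makes the ratios
  in the distortion genuine Lipschitz quotients.
\<close>

lemma dist_lattice_pos:
  assumes "x \<notin> L"
  shows "0 < dist_lattice x"
proof -
  let ?S = "{v \<in> L. norm v \<le> norm x + 1}"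
  let ?r = "Min (insert 1 ((\<lambda>v. norm (x - v)) ` ?S))"
  have fin: "finite (insert 1 ((\<lambda>v. norm (x - v)) ` ?S))"
    using finite_lattice_ball by simp
  have "0 < ?r"
    using fin assms by (subst Min_gr_iff) auto
  also have "?r \<le> dist_lattice x"
  proof (rule dist_lattice_greatest)
    fix v assume v: "v \<in> L"
    show "?r \<le> norm (x - v)"
    proof (cases "norm v \<le> norm x + 1")
      case True
      then show ?thesis using v fin by (intro Min_le) auto
    next
      case False
      then have "1 \<le> norm (x - v)"
        using norm_triangle_ineq2[of v x] by (simp add: norm_minus_commute)
      then show ?thesis
        using Min_le[OF fin, of 1] by simp
    qed
  qed
  finally show ?thesis .
qed

lemma norm_le_dist_lattice: "x \<in> voronoi_cell L \<Longrightarrow> norm x \<le> dist_lattice x"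
  by (rule dist_lattice_greatest) (auto simp: voronoi_cell_def)

section \<open>The spectral gap\<close>

text \<open>
  The energy in the gap hypothesis of \<open>poincare_inequality\<close>, for the displacements \<open>comb (c j)\<close>
  divided by \<open>N = 2 h + 1\<close> and with weights \<open>p j * N\<^sup>2\<close>. A frequency \<open>k\<close> is the dual lattice vector
  \<open>u\<close> with \<open>u \<bullet> b = k b\<close>, and as \<open>N\<close> grows its energy tends to
  \<open>4 * pi\<^sup>2 * (\<Sum>j\<in>J. p j * (u \<bullet> comb (c j))\<^sup>2)\<close>, which is at least
  \<open>4 * pi\<^sup>2 * \<theta> * l\<^sup>2\<close>. The number of frequencies grows with \<open>N\<close>, so this limit alone does not
  give a uniform bound. This is why the basis vectors must occur among the displacements: they
  alone give every frequency with a large coordinate more than enough energy, uniformly in \<open>N\<close>,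
  and only finitely many frequencies remain.
\<close>

lemma spectral_gap:
  assumes "finite J" and p: "\<And>j. j \<in> J \<Longrightarrow> p j \<ge> 0"
    and \<epsilon>: "\<epsilon> > 0" and basis: "\<And>b. b \<in> B \<Longrightarrow> \<exists>j\<in>J. p j \<ge> \<epsilon> \<and> comb (c j) = b"
    and \<theta>: "\<theta> \<ge> 0" "\<And>u. \<theta> * (norm u)\<^sup>2 \<le> (\<Sum>j\<in>J. p j * (u \<bullet> comb (c j))\<^sup>2)"
    and l: "l \<ge> 0" "\<And>u. u \<in> dual_lattice L - {0} \<Longrightarrow> l \<le> norm u"
    and \<gamma>: "\<gamma> < 4 * pi\<^sup>2 * \<theta> * l\<^sup>2"
  shows "eventually (\<lambda>h :: nat. \<forall>k \<in> PiE B (\<lambda>_. {- int h..int h}) - {\<lambda>b\<in>B. 0}.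
      \<gamma> \<le> (\<Sum>j\<in>J. p j * (of_int (2 * int h + 1))\<^sup>2 *
        (cmod (character B (2 * int h + 1) k (c j) - 1))\<^sup>2)) sequentially"
proof -
  define s where "s k j = real_of_int (\<Sum>b\<in>B. k b * c j b)" for k j
  define N where "N h = real_of_int (2 * int h + 1)" for h
  define A where "A h k = (\<Sum>j\<in>J. p j * (4 * (N h * sin (pi * s k j / N h))\<^sup>2))" for h k
  have N_pos: "N h > 0" for h by (simp add: N_def)
  have A: "(\<Sum>j\<in>J. p j * (of_int (2 * int h + 1))\<^sup>2 *
        (cmod (character B (2 * int h + 1) k (c j) - 1))\<^sup>2) = A h k" for h k
    unfolding A_def
  proof (intro sum.cong refl)
    fix j
    have "character B (2 * int h + 1) k (c j) = cis (2 * (pi * s k j / N h))"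
      by (simp add: character_def s_def N_def mult.assoc)
    then show "p j * (of_int (2 * int h + 1))\<^sup>2 * (cmod (character B (2 * int h + 1) k (c j) - 1))\<^sup>2
        = p j * (4 * (N h * sin (pi * s k j / N h))\<^sup>2)"
      by (simp only: cmod_cis_minus_1 N_def power_mult_distrib mult_ac)
  qed
  \<comment> \<open>Frequencies with a coordinate above \<open>R\<close> are handled by a basis displacement alone.\<close>
  obtain R :: nat where R: "\<gamma> / (4 * \<epsilon>) < R"
    using reals_Archimedean2 by blast
  define S where "S = PiE B (\<lambda>_. {- int R..int R}) - {\<lambda>b\<in>B. 0}"
  have "finite S"
    unfolding S_def using finite_basis by (intro finite_Diff finite_PiE) auto
  moreover have "eventually (\<lambda>h. \<gamma> \<le> A h k) sequentially" if k: "k \<in> S" for k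
  proof -
    have N_lim: "filterlim N at_top sequentially"
      unfolding N_def by real_asymp
    have "(\<lambda>h. A h k) \<longlonglongrightarrow> (\<Sum>j\<in>J. p j * (4 * (pi * s k j)\<^sup>2))"
      unfolding A_def by (intro tendsto_intros tendsto_scaled_sin N_lim)
    moreover have "\<gamma> < (\<Sum>j\<in>J. p j * (4 * (pi * s k j)\<^sup>2))"
    proof -
      obtain u where u: "\<And>b. b \<in> B \<Longrightarrow> u \<bullet> b = of_int (k b)"
        using ex_dual_vector[of "\<lambda>b. of_int (k b)"] by auto
      have "u \<in> dual_lattice L"
        by (auto simp: dual_lattice_def inner_comb[OF u])
      moreover have "u \<noteq> 0"
      proof
        assume "u = 0"
        then have "k b = (\<lambda>b\<in>B. 0) b" for b
          using u[of b] k by (cases "b \<in> B") (auto simp: S_def PiE_iff extensional_def)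
        then show False using k by (auto simp: S_def)
      qed
      ultimately have "l \<le> norm u"
        using l by blast
      then have "4 * pi\<^sup>2 * \<theta> * l\<^sup>2 \<le> 4 * pi\<^sup>2 * (\<theta> * (norm u)\<^sup>2)"
        using l \<theta> by (simp add: mult.assoc mult_left_mono power_mono)
      also have "\<dots> \<le> 4 * pi\<^sup>2 * (\<Sum>j\<in>J. p j * (u \<bullet> comb (c j))\<^sup>2)"
        using \<theta>(2) by (intro mult_left_mono) auto
      also have "\<dots> = (\<Sum>j\<in>J. p j * (4 * (pi * s k j)\<^sup>2))"
      proof -
        have "u \<bullet> comb (c j) = s k j" for j
          unfolding s_def by (rule inner_comb[OF u])
        then show ?thesis
          by (simp add: sum_distrib_left power_mult_distrib mult_ac)
      qed
      finally show ?thesis using \<gamma> by simp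
    qed
    ultimately have "eventually (\<lambda>h. \<gamma> < A h k) sequentially"
      by (rule order_tendstoD(1))
    then show ?thesis by (rule eventually_mono) simp
  qed
  ultimately have "eventually (\<lambda>h. \<forall>k\<in>S. \<gamma> \<le> A h k) sequentially"
    by (simp add: eventually_ball_finite_distrib)
  then show ?thesis
    unfolding A
  proof (rule eventually_mono, intro ballI)
    fix h k assume small: "\<forall>k\<in>S. \<gamma> \<le> A h k"
      and k: "k \<in> PiE B (\<lambda>_. {- int h..int h}) - {\<lambda>b\<in>B. 0}"
    show "\<gamma> \<le> A h k"
    proof (cases "k \<in> S")
      case True
      then show ?thesis using small by blast
    next
      case False
      then obtain b where b: "b \<in> B" "k b \<notin> {- int R..int R}"
        using k by (auto simp: S_def PiE_iff)
      then have kb: "int R + 1 \<le> \<bar>k b\<bar>" by auto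
      obtain j where j: "j \<in> J" "p j \<ge> \<epsilon>" "comb (c j) = b"
        using basis[OF b(1)] by blast
      obtain u where u: "\<And>b. b \<in> B \<Longrightarrow> u \<bullet> b = of_int (k b)"
        using ex_dual_vector[of "\<lambda>b. of_int (k b)"] by auto
      have s: "s k j = k b"
        using inner_comb[OF u, of "c j"] u[OF b(1)] j(3) by (simp add: s_def)
      \<comment> \<open>Centred frequencies keep the argument of the squared sine within half a period of 0.\<close>
      have "\<bar>k b\<bar> \<le> int h"
        using k b(1) by (auto simp: PiE_iff abs_le_iff)
      then have "\<bar>of_int (k b) / N h\<bar> \<le> 1 / 2"
        using N_pos[of h] by (simp add: N_def field_simps)
      then have "(N h * (of_int (k b) / N h))\<^sup>2 \<le> (N h * sin (pi * (of_int (k b) / N h)))\<^sup>2"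
        unfolding power_mult_distrib by (intro mult_left_mono sin_squared_ge) auto
      then have *: "(of_int (k b))\<^sup>2 \<le> (N h * sin (pi * s k j / N h))\<^sup>2"
        using N_pos[of h] by (simp add: s)
      have "real R \<le> (of_int (k b))\<^sup>2"
      proof -
        have "int R \<le> \<bar>k b\<bar> * \<bar>k b\<bar>"
          using kb mult_mono[of 1 "\<bar>k b\<bar>" "int R" "\<bar>k b\<bar>"] by simp
        then have "real_of_int (int R) \<le> real_of_int ((k b)\<^sup>2)"
          by (subst of_int_le_iff) (simp add: power2_eq_square)
        then show ?thesis by simp
      qed
      then have "\<gamma> / (4 * \<epsilon>) \<le> (N h * sin (pi * s k j / N h))\<^sup>2"
        using R * by linarith
      then have "\<gamma> \<le> \<epsilon> * (4 * (N h * sin (pi * s k j / N h))\<^sup>2)"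
        using \<epsilon> by (simp add: field_simps)
      also have "\<dots> \<le> p j * (4 * (N h * sin (pi * s k j / N h))\<^sup>2)"
        using j by (intro mult_right_mono) auto
      also have "\<dots> \<le> A h k"
        unfolding A_def using j(1) assms(1) p by (intro member_le_sum) auto
      finally show ?thesis .
    qed
  qed
qed

section \<open>Displacements of embeddings\<close>

lemma comb_shift_mod:
  assumes "N > 0"
  shows "\<exists>v\<in>L. (comb m + comb g) /\<^sub>R of_int N = comb (shift_mod B N g m) /\<^sub>R of_int N + v"
proof
  let ?q = "\<lambda>b. (m b + g b) div N"
  have "comb m + comb g = comb (\<lambda>b. shift_mod B N g m b + N * ?q b)"
    unfolding comb_add[symmetric] by (rule comb_cong) (simp add: shift_mod_def)
  then show "(comb m + comb g) /\<^sub>R of_int N = comb (shift_mod B N g m) /\<^sub>R of_int N + comb ?q"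
    using assms by (simp add: comb_add comb_mult scaleR_right_distrib)
qed simp

text \<open>
  The values of \<open>F\<close> on the points \<open>comb m\<close> divided by \<open>N\<close>, with \<open>0 \<le> m b < N\<close>, form a function
  on a finite abelian group, and adding a grid vector acts on it as a cyclic shift. In
  \<open>poincare_inequality\<close> the displacement \<open>y\<close> is bounded below through \<open>lower\<close> and the
  displacements \<open>c j\<close>, of length \<open>norm (comb (c j)) / N\<close>, are bounded above through \<open>upper\<close>; the
  powers of \<open>N\<close> cancel.
\<close>

lemma displacement_bound_on_grid:
  fixes F :: "real ^ 'n \<Rightarrow> 'h::complex_hilbert" and h :: nat
  defines "N \<equiv> 2 * int h + 1"
  assumes periodic: "\<And>x v. v \<in> L \<Longrightarrow> F (x + v) = F x"
    and upper: "\<And>x y. norm (F x - F y) \<le> s1 * norm (x - y)"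
    and lower: "\<And>x y. dist_lattice (x - y) \<le> s2 * norm (F x - F y)"
    and p: "\<And>j. j \<in> J \<Longrightarrow> p j \<ge> 0" and \<gamma>: "\<gamma> \<ge> 0"
    and gap: "\<And>k. k \<in> PiE B (\<lambda>_. {- int h..int h}) - {\<lambda>b\<in>B. 0} \<Longrightarrow>
      \<gamma> \<le> (\<Sum>j\<in>J. p j * (of_int N)\<^sup>2 * (cmod (character B N k (c j) - 1))\<^sup>2)"
  shows "\<gamma> * (dist_lattice (comb y /\<^sub>R of_int N))\<^sup>2
    \<le> 4 * (s1 * s2)\<^sup>2 * (\<Sum>j\<in>J. p j * (norm (comb (c j)))\<^sup>2)"
proof -
  let ?I = "PiE B (\<lambda>_. {0..<N})"
  define f where "f m = F (comb m /\<^sub>R of_int N)" for m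
  have N: "N > 0" by (simp add: N_def)
  have f_shift: "f (shift_mod B N g m) = F ((comb m + comb g) /\<^sub>R of_int N)" for g m
    using comb_shift_mod[OF N, of m g] periodic by (auto simp: f_def)
  have diff: "(comb m + comb g) /\<^sub>R of_int N - comb m /\<^sub>R of_int N = comb g /\<^sub>R of_int N" for g m
    by (simp add: algebra_simps)
  have fin: "finite ?I" and card: "card ?I > 0"
    using finite_basis N by (auto intro!: finite_PiE simp: card_PiE prod_pos)
  let ?d = "dist_lattice (comb y /\<^sub>R of_int N)"
  have d_nonneg: "?d \<ge> 0"
    by (rule dist_lattice_greatest) simp
  have "real (card ?I) * (\<gamma> * ?d\<^sup>2) = \<gamma> * (\<Sum>m\<in>?I. ?d\<^sup>2)"
    by simp
  also have "\<dots> \<le> \<gamma> * (\<Sum>m\<in>?I. s2\<^sup>2 * (norm (f (shift_mod B N y m) - f m))\<^sup>2)"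
  proof (intro mult_left_mono sum_mono \<gamma>)
    fix m
    have "?d \<le> s2 * norm (f (shift_mod B N y m) - f m)"
      using lower[of "(comb m + comb y) /\<^sub>R of_int N" "comb m /\<^sub>R of_int N"]
      unfolding diff by (simp only: f_shift) (simp only: f_def)
    then show "?d\<^sup>2 \<le> s2\<^sup>2 * (norm (f (shift_mod B N y m) - f m))\<^sup>2"
      using d_nonneg by (metis power_mono power_mult_distrib)
  qed
  also have "\<dots> = s2\<^sup>2 * (\<gamma> * (\<Sum>m\<in>?I. (norm (f (shift_mod B N y m) - f m))\<^sup>2))"
    by (simp add: sum_distrib_left mult_ac)
  also have "\<dots> \<le> s2\<^sup>2 * (4 * (\<Sum>j\<in>J. p j * (of_int N)\<^sup>2 *
      (\<Sum>m\<in>?I. (norm (f (shift_mod B N (c j) m) - f m))\<^sup>2)))"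
  proof (intro mult_left_mono zero_le_power2)
    show "\<gamma> * (\<Sum>m\<in>?I. (norm (f (shift_mod B N y m) - f m))\<^sup>2)
        \<le> 4 * (\<Sum>j\<in>J. p j * (of_int N)\<^sup>2 * (\<Sum>m\<in>?I. (norm (f (shift_mod B N (c j) m) - f m))\<^sup>2))"
    proof (rule poincare_inequality[where \<psi> = "character B N" and z = "\<lambda>g k. character B N k g"
          and c = "of_int N ^ card B" and K = "PiE B (\<lambda>_. {- int h..int h})" and ?k0.0 = "\<lambda>b\<in>B. 0"])
      show "(\<Sum>k\<in>PiE B (\<lambda>_. {- int h..int h}). cnj (character B N k m) * character B N k m') =
          (if m = m' then complex_of_real (of_int N ^ card B) else 0)"
        if "m \<in> ?I" "m' \<in> ?I" for m m'
        unfolding N_def by (rule character_orthogonal) (use that finite_basis in \<open>simp_all add: N_def\<close>)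
      show "character B N (\<lambda>b\<in>B. 0) g = 1" for g
        by (simp add: character_def)
      show "bij_betw (shift_mod B N g) ?I ?I" for g
        using N by (rule bij_betw_shift_mod)
      show "character B N k (shift_mod B N g m) = character B N k g * character B N k m" for g k m
        using N by (rule character_shift_mod)
      show "cmod (character B N k g) = 1" for g k
        by (simp add: character_def)
    qed (use fin N \<gamma> gap in auto)
  qed
  also have "\<dots> \<le> s2\<^sup>2 * (4 * (\<Sum>j\<in>J. p j * (of_int N)\<^sup>2 *
      (\<Sum>m\<in>?I. (s1 * (norm (comb (c j)) / of_int N))\<^sup>2)))"
  proof (intro mult_left_mono sum_mono power_mono)
    fix j m
    show "norm (f (shift_mod B N (c j) m) - f m) \<le> s1 * (norm (comb (c j)) / of_int N)"
      using upper[of "(comb m + comb (c j)) /\<^sub>R of_int N" "comb m /\<^sub>R of_int N"] N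
      unfolding diff f_shift by (simp add: f_def divide_inverse mult.commute)
  qed (use p in auto)
  also have "\<dots> = real (card ?I) * (4 * (s1 * s2)\<^sup>2 * (\<Sum>j\<in>J. p j * (norm (comb (c j)))\<^sup>2))"
    using N by (simp add: sum_distrib_left power_mult_distrib power_divide mult_ac)
  finally show ?thesis
    using card by simp
qed

text \<open>
  Two limits: the grid is refined until a grid point approaches \<open>x\<close>, and then \<open>\<gamma>\<close> is raised to
  the limiting value of the spectral gap.
\<close>

lemma displacement_bound:
  fixes F :: "real ^ 'n \<Rightarrow> 'h::complex_hilbert"
  assumes periodic: "\<And>x v. v \<in> L \<Longrightarrow> F (x + v) = F x"
    and upper: "\<And>x y. norm (F x - F y) \<le> s1 * norm (x - y)"
    and lower: "\<And>x y. dist_lattice (x - y) \<le> s2 * norm (F x - F y)"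
    and "finite J" and p: "\<And>j. j \<in> J \<Longrightarrow> p j \<ge> 0"
    and \<epsilon>: "\<epsilon> > 0" and basis: "\<And>b. b \<in> B \<Longrightarrow> \<exists>j\<in>J. p j \<ge> \<epsilon> \<and> comb (c j) = b"
    and \<theta>: "\<theta> \<ge> 0" "\<And>u. \<theta> * (norm u)\<^sup>2 \<le> (\<Sum>j\<in>J. p j * (u \<bullet> comb (c j))\<^sup>2)"
    and l: "l \<ge> 0" "\<And>u. u \<in> dual_lattice L - {0} \<Longrightarrow> l \<le> norm u"
  shows "pi\<^sup>2 * \<theta> * l\<^sup>2 * (dist_lattice x)\<^sup>2 \<le> (s1 * s2)\<^sup>2 * (\<Sum>j\<in>J. p j * (norm (comb (c j)))\<^sup>2)"
proof -
  let ?T = "\<Sum>j\<in>J. p j * (norm (comb (c j)))\<^sup>2"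
  let ?G = "4 * pi\<^sup>2 * \<theta> * l\<^sup>2"
  define N where "N h = real_of_int (2 * int h + 1)" for h :: nat
  have N_lim: "filterlim N at_top sequentially"
    unfolding N_def by real_asymp
  have d_nonneg: "dist_lattice x \<ge> 0" for x
    by (rule dist_lattice_greatest) simp
  have bound: "\<gamma> * (dist_lattice x)\<^sup>2 \<le> 4 * (s1 * s2)\<^sup>2 * ?T" if \<gamma>: "0 \<le> \<gamma>" "\<gamma> < ?G" for \<gamma>
  proof -
    obtain C where C: "C \<ge> 0" "\<And>M. M > 0 \<Longrightarrow> \<exists>y. norm (comb y /\<^sub>R M - x) \<le> C / M"
      using ex_comb_near[of x] by blast
    have "eventually (\<lambda>h. \<gamma> * (max 0 (dist_lattice x - C / N h))\<^sup>2 \<le> 4 * (s1 * s2)\<^sup>2 * ?T) sequentially"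
      using spectral_gap[OF assms(4) p \<epsilon> basis \<theta> l \<gamma>(2)]
    proof (rule eventually_mono)
      fix h :: nat
      assume gap: "\<forall>k \<in> PiE B (\<lambda>_. {- int h..int h}) - {\<lambda>b\<in>B. 0}.
        \<gamma> \<le> (\<Sum>j\<in>J. p j * (of_int (2 * int h + 1))\<^sup>2 *
          (cmod (character B (2 * int h + 1) k (c j) - 1))\<^sup>2)"
      obtain y where y: "norm (comb y /\<^sub>R N h - x) \<le> C / N h"
        using C(2)[of "N h"] by (auto simp: N_def)
      have "max 0 (dist_lattice x - C / N h) \<le> dist_lattice (comb y /\<^sub>R N h)"
        using dist_lattice_lipschitz[of x "comb y /\<^sub>R N h"] y d_nonneg[of "comb y /\<^sub>R N h"] by simp
      then have "\<gamma> * (max 0 (dist_lattice x - C / N h))\<^sup>2 \<le> \<gamma> * (dist_lattice (comb y /\<^sub>R N h))\<^sup>2"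
        using \<gamma>(1) by (intro mult_left_mono power_mono) auto
      also have "\<dots> \<le> 4 * (s1 * s2)\<^sup>2 * ?T"
        unfolding N_def
        by (rule displacement_bound_on_grid[where F = F]) (use periodic upper lower p \<gamma>(1) gap in auto)
      finally show "\<gamma> * (max 0 (dist_lattice x - C / N h))\<^sup>2 \<le> 4 * (s1 * s2)\<^sup>2 * ?T" .
    qed
    moreover have "(\<lambda>h. \<gamma> * (max 0 (dist_lattice x - C / N h))\<^sup>2) \<longlonglongrightarrow> \<gamma> * (max 0 (dist_lattice x - 0))\<^sup>2"
      by (intro tendsto_intros tendsto_divide_0[OF tendsto_const]
          filterlim_at_top_imp_at_infinity N_lim)
    ultimately have "\<gamma> * (max 0 (dist_lattice x - 0))\<^sup>2 \<le> 4 * (s1 * s2)\<^sup>2 * ?T"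
      by (intro tendsto_upperbound) auto
    then show ?thesis
      using d_nonneg[of x] by simp
  qed
  have "?G * (dist_lattice x)\<^sup>2 \<le> 4 * (s1 * s2)\<^sup>2 * ?T"
  proof (cases "?G = 0")
    case True
    have "0 \<le> 4 * (s1 * s2)\<^sup>2 * ?T"
      using p by (intro mult_nonneg_nonneg sum_nonneg) auto
    then show ?thesis
      by (simp only: True mult_zero_left)
  next
    case False
    moreover have "?G \<ge> 0" using \<theta>(1) by simp
    ultimately have G: "?G > 0" by linarith
    show ?thesis
    proof (rule field_le_mult_one_interval)
      fix t :: real assume "0 < t" "t < 1"
      then have "0 \<le> t * ?G" "t * ?G < ?G"
        using G mult_strict_right_mono[of t 1 ?G] by simp_all
      then show "t * (?G * (dist_lattice x)\<^sup>2) \<le> 4 * (s1 * s2)\<^sup>2 * ?T"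
        using bound[of "t * ?G"] by (simp only: mult.assoc)
    qed
  qed
  then show ?thesis by simp
qed

text \<open>
  The displacements are chosen so that the quadratic form \<open>\<Sum>j\<in>J. p j * (u \<bullet> comb (c j))\<^sup>2\<close> is
  almost \<open>(norm u)\<^sup>2\<close>: lattice vectors near \<open>M\<close> times the standard unit vectors with weight
  \<open>1 / M\<^sup>2\<close>, together with the lattice basis at the negligible weight \<open>1 / M\<close>. The trace of the
  form, which bounds the total cost of the displacements, then tends to the dimension; this is the
  source of the factor \<open>sqrt n\<close>.
\<close>

lemma dist_lattice_bound:
  fixes F :: "real ^ 'n \<Rightarrow> 'h::complex_hilbert"
  assumes periodic: "\<And>x v. v \<in> L \<Longrightarrow> F (x + v) = F x"
    and upper: "\<And>x y. norm (F x - F y) \<le> s1 * norm (x - y)"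
    and lower: "\<And>x y. dist_lattice (x - y) \<le> s2 * norm (F x - F y)"
    and l: "l \<ge> 0" "\<And>u. u \<in> dual_lattice L - {0} \<Longrightarrow> l \<le> norm u"
  shows "pi\<^sup>2 * l\<^sup>2 * (dist_lattice x)\<^sup>2 \<le> (s1 * s2)\<^sup>2 * real CARD('n)"
proof -
  let ?e = "\<lambda>i :: 'n. axis i (1 :: real)"
  let ?n = "real CARD('n)"
  let ?S = "\<Sum>b\<in>B. (norm b)\<^sup>2"
  have "\<forall>i. \<exists>C\<ge>0. \<forall>M>0. \<exists>c. norm (comb c /\<^sub>R M - ?e i) \<le> C / M"
    using ex_comb_near by blast
  then obtain C' where C': "\<And>i. C' i \<ge> 0" "\<And>i M. M > 0 \<Longrightarrow> \<exists>c. norm (comb c /\<^sub>R M - ?e i) \<le> C' i / M"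
    by metis
  define C where "C = (\<Sum>i\<in>UNIV. C' i)"
  have C'_le: "C' i \<le> C" for i
    unfolding C_def using C'(1) by (intro member_le_sum) auto
  have bound: "pi\<^sup>2 * (1 - 2 * ?n * C / M) * l\<^sup>2 * (dist_lattice x)\<^sup>2
      \<le> (s1 * s2)\<^sup>2 * (?n * (1 + C / M)\<^sup>2 + ?S / M)"
    if M: "M > 0" "1 - 2 * ?n * C / M \<ge> 0" for M
  proof -
    have "\<forall>i. \<exists>c. norm (comb c /\<^sub>R M - ?e i) \<le> C / M"
      using C'(2)[OF M(1)] C'_le M(1) by (meson divide_right_mono less_imp_le order_trans)
    then obtain a where a: "\<And>i. norm (comb (a i) /\<^sub>R M - ?e i) \<le> C / M"
      by metis
    define w where "w i = comb (a i) /\<^sub>R M" for i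
    define p where "p = case_sum (\<lambda>_ :: 'n. 1 / M\<^sup>2) (\<lambda>_ :: real ^ 'n. 1 / M)"
    define c where "c = case_sum a (\<lambda>b b' :: real ^ 'n. if b' = b then 1 else 0)"
    define J where "J = (UNIV :: 'n set) <+> B"
    have sum_J: "(\<Sum>j\<in>J. p j * f (comb (c j))) = (\<Sum>i\<in>UNIV. f (comb (a i)) / M\<^sup>2) + (\<Sum>b\<in>B. f b / M)" for f
      unfolding J_def using finite_basis by (simp add: sum.Plus p_def c_def comb_unit)
    have "pi\<^sup>2 * (1 - 2 * ?n * C / M) * l\<^sup>2 * (dist_lattice x)\<^sup>2
        \<le> (s1 * s2)\<^sup>2 * (\<Sum>j\<in>J. p j * (norm (comb (c j)))\<^sup>2)"
    proof (rule displacement_bound[where F = F and \<epsilon> = "1 / M"])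
      show "finite J"
        using finite_basis by (simp add: J_def)
      show "p j \<ge> 0" for j
        using M(1) by (simp add: p_def split: sum.split)
      show "1 / M > 0"
        using M(1) by simp
      show "\<exists>j\<in>J. p j \<ge> 1 / M \<and> comb (c j) = b" if "b \<in> B" for b
        using that by (intro bexI[of _ "Inr b"]) (auto simp: J_def p_def c_def comb_unit)
      show "(1 - 2 * ?n * C / M) * (norm u)\<^sup>2 \<le> (\<Sum>j\<in>J. p j * (u \<bullet> comb (c j))\<^sup>2)" for u
      proof -
        have "(u $ i)\<^sup>2 - 2 * (norm u)\<^sup>2 * (C / M) \<le> (u \<bullet> comb (a i))\<^sup>2 / M\<^sup>2" for i
        proof -
          \<comment> \<open>A square perturbed by \<open>\<delta>\<close> loses at most twice the cross term.\<close>
          let ?\<delta> = "u \<bullet> (w i - ?e i)"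
          have "\<bar>?\<delta>\<bar> \<le> norm u * (C / M)"
            using a[of i] unfolding w_def
            by (intro order_trans[OF Cauchy_Schwarz_ineq2] mult_left_mono) auto
          then have "\<bar>u $ i\<bar> * \<bar>?\<delta>\<bar> \<le> norm u * (norm u * (C / M))"
            by (intro mult_mono component_le_norm_cart) auto
          then have "\<bar>u $ i * ?\<delta>\<bar> \<le> (norm u)\<^sup>2 * (C / M)"
            by (simp add: abs_mult power2_eq_square mult.assoc)
          then have "- ((norm u)\<^sup>2 * (C / M)) \<le> u $ i * ?\<delta>"
            by linarith
          moreover have "(u $ i)\<^sup>2 + 2 * (u $ i * ?\<delta>) \<le> (u $ i + ?\<delta>)\<^sup>2"
            by (simp add: power2_sum)
          moreover have "u $ i + ?\<delta> = u \<bullet> comb (a i) / M"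
            by (simp add: w_def inner_diff_right inner_axis divide_inverse mult.commute)
          ultimately show ?thesis
            by (simp add: power_divide)
        qed
        then have "(\<Sum>i\<in>UNIV. (u $ i)\<^sup>2 - 2 * (norm u)\<^sup>2 * (C / M)) \<le> (\<Sum>i\<in>UNIV. (u \<bullet> comb (a i))\<^sup>2 / M\<^sup>2)"
          by (rule sum_mono)
        moreover have "(\<Sum>i\<in>UNIV. (u $ i)\<^sup>2) = (norm u)\<^sup>2"
          by (simp add: norm_vec_def L2_set_def sum_nonneg)
        moreover have "0 \<le> (\<Sum>b\<in>B. (u \<bullet> b)\<^sup>2 / M)"
          using M(1) by (intro sum_nonneg) auto
        ultimately show ?thesis
          by (simp add: sum_J[of "\<lambda>v. (u \<bullet> v)\<^sup>2"] sum_subtractf algebra_simps)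
      qed
    qed (use assms M in auto)
    also have "(\<Sum>j\<in>J. p j * (norm (comb (c j)))\<^sup>2) \<le> ?n * (1 + C / M)\<^sup>2 + ?S / M"
    proof -
      have "(norm (comb (a i)))\<^sup>2 / M\<^sup>2 \<le> (1 + C / M)\<^sup>2" for i
      proof -
        have "norm (w i) \<le> norm (?e i) + norm (w i - ?e i)"
          using norm_triangle_ineq[of "?e i" "w i - ?e i"] by simp
        then have "norm (w i) \<le> 1 + C / M"
          using a[of i] by (simp add: w_def)
        then have "(norm (w i))\<^sup>2 \<le> (1 + C / M)\<^sup>2"
          by (intro power_mono) auto
        then show ?thesis
          using M(1) by (simp add: w_def power_mult_distrib divide_inverse power_inverse mult.commute)
      qed
      then have "(\<Sum>i\<in>(UNIV :: 'n set). (norm (comb (a i)))\<^sup>2 / M\<^sup>2) \<le> (\<Sum>i\<in>(UNIV :: 'n set). (1 + C / M)\<^sup>2)"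
        by (intro sum_mono) auto
      then show ?thesis
        by (simp add: sum_J[of "\<lambda>v. (norm v)\<^sup>2"] sum_divide_distrib)
    qed
    finally show ?thesis
      by (simp add: mult_left_mono)
  qed
  have theta_lim: "((\<lambda>M. 1 - 2 * ?n * C / M) \<longlongrightarrow> 1) at_top"
    by real_asymp
  have "eventually (\<lambda>M. pi\<^sup>2 * (1 - 2 * ?n * C / M) * l\<^sup>2 * (dist_lattice x)\<^sup>2
      \<le> (s1 * s2)\<^sup>2 * (?n * (1 + C / M)\<^sup>2 + ?S / M)) at_top"
    using eventually_gt_at_top[of 0] order_tendstoD(1)[OF theta_lim, of 0, simplified]
    by eventually_elim (intro bound, auto)
  moreover have "((\<lambda>M. pi\<^sup>2 * (1 - 2 * ?n * C / M) * l\<^sup>2 * (dist_lattice x)\<^sup>2)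
      \<longlongrightarrow> pi\<^sup>2 * 1 * l\<^sup>2 * (dist_lattice x)\<^sup>2) at_top"
    by (intro tendsto_intros theta_lim)
  moreover have "((\<lambda>M. (s1 * s2)\<^sup>2 * (?n * (1 + C / M)\<^sup>2 + ?S / M))
      \<longlongrightarrow> (s1 * s2)\<^sup>2 * (?n * (1 + 0)\<^sup>2 + 0)) at_top"
    by (intro tendsto_intros tendsto_divide_0[OF tendsto_const]
        filterlim_at_top_imp_at_infinity filterlim_ident)
  ultimately have "pi\<^sup>2 * 1 * l\<^sup>2 * (dist_lattice x)\<^sup>2 \<le> (s1 * s2)\<^sup>2 * (?n * (1 + 0)\<^sup>2 + 0)"
    by (intro tendsto_le[OF trivial_limit_at_top_linorder]) auto
  then show ?thesis by simp
qed

lemma basis_nonempty: "B \<noteq> {}"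
proof
  assume "B = {}"
  then have "axis undefined 1 = (0 :: real ^ 'n)"
    using span by auto
  then show False by (simp add: axis_eq_0_iff)
qed

lemma ex_dual_lattice_nonzero: "\<exists>u. u \<in> dual_lattice L - {0}"
proof -
  obtain b where b: "b \<in> B"
    using basis_nonempty by blast
  obtain u where u: "\<And>b. b \<in> B \<Longrightarrow> u \<bullet> b = of_int 1"
    using ex_dual_vector[of "\<lambda>_. of_int 1"] by blast
  have "u \<in> dual_lattice L"
    by (auto simp: dual_lattice_def inner_comb[OF u])
  moreover have "u \<noteq> 0"
    using u[OF b] by auto
  ultimately show ?thesis by blast
qed

text \<open>
  Half a basis vector pairs to \<open>1 / 2\<close> with a dual vector. This yields two distinct points of
  the torus, which are needed to know that the suprema in the distortion are positive.
\<close>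

lemma ex_not_lattice: "\<exists>x. x \<notin> L"
proof -
  obtain b where b: "b \<in> B"
    using basis_nonempty by blast
  obtain u where u: "\<And>b. b \<in> B \<Longrightarrow> u \<bullet> b = of_int 1"
    using ex_dual_vector[of "\<lambda>_. of_int 1"] by blast
  have "(1 / 2) *\<^sub>R b \<notin> L"
  proof
    assume "(1 / 2) *\<^sub>R b \<in> L"
    then obtain c where "(1 / 2) *\<^sub>R b = comb c" by blast
    then have "u \<bullet> ((1 / 2) *\<^sub>R b) = of_int (\<Sum>b\<in>B. 1 * c b)"
      by (simp only: inner_comb[OF u])
    then have "(1 :: real) = of_int (2 * (\<Sum>b\<in>B. 1 * c b))"
      using u[OF b] by simp
    then have "1 = 2 * (\<Sum>b\<in>B. 1 * c b)"
      by (simp only: of_int_eq_1_iff)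
    then show False by presburger
  qed
  then show ?thesis by blast
qed

text \<open>
  Every point of the Voronoi cell is its own shortest representative, so its norm is bounded point
  by point and the supremum follows.
\<close>

lemma covering_radius_bound:
  fixes F :: "real ^ 'n \<Rightarrow> 'h::complex_hilbert"
  assumes periodic: "\<And>x v. v \<in> L \<Longrightarrow> F (x + v) = F x"
    and upper: "\<And>x y. norm (F x - F y) \<le> s1 * norm (x - y)"
    and lower: "\<And>x y. dist_lattice (x - y) \<le> s2 * norm (F x - F y)"
    and s: "s1 \<ge> 0" "s2 \<ge> 0"
  shows "pi * shortest_length (dual_lattice L) * covering_radius L / sqrt (real CARD('n)) \<le> s1 * s2"
proof -
  let ?l = "shortest_length (dual_lattice L)"
  let ?D = "s1 * s2 * sqrt (real CARD('n))"
  have l_le: "?l \<le> norm u" if "u \<in> dual_lattice L - {0}" for u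
    unfolding shortest_length_def by (rule cINF_lower[OF _ that]) (auto intro: bdd_belowI[of _ 0])
  have l_nonneg: "?l \<ge> 0"
    unfolding shortest_length_def using ex_dual_lattice_nonzero by (intro cINF_greatest) auto
  have D: "?D \<ge> 0" using s by simp
  have "pi * ?l * covering_radius L \<le> ?D"
  proof (cases "?l = 0")
    case False
    then have l: "pi * ?l > 0" using l_nonneg by simp
    have "covering_radius L \<le> ?D / (pi * ?l)"
      unfolding covering_radius_def
    proof (rule cSUP_least)
      show "voronoi_cell L \<noteq> {}"
        by (auto simp: voronoi_cell_def intro!: exI[of _ 0])
      fix x assume "x \<in> voronoi_cell L"
      then have "norm x \<le> dist_lattice x"
        by (rule norm_le_dist_lattice)
      then have "(pi * ?l * norm x)\<^sup>2 \<le> pi\<^sup>2 * ?l\<^sup>2 * (dist_lattice x)\<^sup>2"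
        unfolding power_mult_distrib by (intro mult_left_mono power_mono) auto
      also have "\<dots> \<le> (s1 * s2)\<^sup>2 * real CARD('n)"
        by (rule dist_lattice_bound[OF periodic upper lower l_nonneg l_le])
      also have "\<dots> = ?D\<^sup>2"
        by (simp add: power_mult_distrib)
      finally have "pi * ?l * norm x \<le> ?D"
        using D by (rule power2_le_imp_le)
      then show "norm x \<le> ?D / (pi * ?l)"
        using l by (simp add: field_simps)
    qed
    then show ?thesis
      using l by (simp add: field_simps)
  qed (use D in simp)
  then show ?thesis
    by (simp add: divide_le_eq)
qed

section \<open>Distortion\<close>

lemma torus_dist_eq: "torus_dist L (lattice_rel L `` {x}) (lattice_rel L `` {y}) = dist_lattice (x - y)"
  by (simp add: torus_dist_coset[OF is_lattice_L] dist_lattice_def)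

lemma coset_eq_iff: "lattice_rel L `` {x} = lattice_rel L `` {y} \<longleftrightarrow> x - y \<in> L"
  using eq_equiv_class_iff[OF equiv_lattice_rel[OF is_lattice_L], of x y] by (simp add: lattice_rel_def)

lemma coset_in_torus: "lattice_rel L `` {x} \<in> torus L"
  by (simp add: torus_def quotientI)

text \<open>
  The suprema \<open>S1\<close> and \<open>S2\<close> are the best Lipschitz constants of \<open>\<phi>\<close> and of its inverse. Both are
  positive, so an infinite one makes the product infinite; otherwise \<open>covering_radius_bound\<close>
  applies to \<open>\<phi>\<close> pulled back to the whole space.
\<close>

lemma distortion_ge:
  fixes \<phi> :: "(real ^ 'n) set \<Rightarrow> 'h::complex_hilbert"
  assumes inj: "inj_on \<phi> (torus L)"
  shows "ereal (pi * shortest_length (dual_lattice L) * covering_radius L / sqrt (real CARD('n)))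
    \<le> distortion L \<phi>"
proof -
  let ?cl = "\<lambda>x. lattice_rel L `` {x}"
  let ?P = "{(X, Y). X \<in> torus L \<and> Y \<in> torus L \<and> X \<noteq> Y}"
  define S1 where "S1 = (SUP (X, Y) \<in> ?P. ereal (norm (\<phi> X - \<phi> Y) / torus_dist L X Y))"
  define S2 where "S2 = (SUP (X, Y) \<in> ?P. ereal (torus_dist L X Y / norm (\<phi> X - \<phi> Y)))"
  have dist_pos: "dist_lattice (x - y) > 0" and norm_pos: "norm (\<phi> (?cl x) - \<phi> (?cl y)) > 0"
    if "?cl x \<noteq> ?cl y" for x y
    using that dist_lattice_pos[of "x - y"] inj_onD[OF inj _ coset_in_torus coset_in_torus]
    by (auto simp: coset_eq_iff)
  have S1_ge: "ereal (norm (\<phi> (?cl x) - \<phi> (?cl y)) / dist_lattice (x - y)) \<le> S1"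
    and S2_ge: "ereal (dist_lattice (x - y) / norm (\<phi> (?cl x) - \<phi> (?cl y))) \<le> S2"
    if "?cl x \<noteq> ?cl y" for x y
    unfolding S1_def S2_def torus_dist_eq[symmetric]
    using that coset_in_torus by (auto intro!: SUP_upper2[of "(?cl x, ?cl y)"])
  obtain x0 where "x0 \<notin> L"
    using ex_not_lattice by blast
  then have ne: "?cl x0 \<noteq> ?cl 0"
    by (simp add: coset_eq_iff)
  have S1_pos: "S1 > 0"
    using S1_ge[OF ne] dist_pos[OF ne] norm_pos[OF ne]
    by (intro less_le_trans[OF _ S1_ge[OF ne]]) simp
  have S2_pos: "S2 > 0"
    using S2_ge[OF ne] dist_pos[OF ne] norm_pos[OF ne]
    by (intro less_le_trans[OF _ S2_ge[OF ne]]) simp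
  have dist: "distortion L \<phi> = S1 * S2"
    by (simp add: distortion_def S1_def S2_def)
  show ?thesis
  proof (cases "S1 = \<infinity> \<or> S2 = \<infinity>")
    case True
    then have "S1 * S2 = \<infinity>"
      using S1_pos S2_pos by (auto simp: ereal_mult_eq_PInfty)
    then show ?thesis
      unfolding dist by (simp only: ereal_less_eq(1))
  next
    case False
    then obtain s1 s2 where s: "S1 = ereal s1" "S2 = ereal s2"
      using False S1_pos S2_pos by (cases S1; cases S2) auto
    have s_pos: "s1 > 0" "s2 > 0"
      using S1_pos S2_pos by (auto simp: s)
    have "pi * shortest_length (dual_lattice L) * covering_radius L / sqrt (real CARD('n)) \<le> s1 * s2"
    proof (rule covering_radius_bound[where F = "\<lambda>x. \<phi> (?cl x)"])
      show "\<phi> (?cl (x + v)) = \<phi> (?cl x)" if "v \<in> L" for x v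
        using that coset_eq_iff[of "x + v" x] by simp
      show "norm (\<phi> (?cl x) - \<phi> (?cl y)) \<le> s1 * norm (x - y)" for x y
      proof (cases "?cl x = ?cl y")
        case True
        then show ?thesis using s_pos by (simp only: True) simp
      next
        case False
        then have "norm (\<phi> (?cl x) - \<phi> (?cl y)) \<le> s1 * dist_lattice (x - y)"
          using S1_ge[OF False] dist_pos[OF False] by (simp add: s divide_le_eq)
        also have "\<dots> \<le> s1 * norm (x - y)"
          using s_pos by (intro mult_left_mono dist_lattice_le_norm) auto
        finally show ?thesis .
      qed
      show "dist_lattice (x - y) \<le> s2 * norm (\<phi> (?cl x) - \<phi> (?cl y))" for x y
      proof (cases "?cl x = ?cl y")
        case True
        then have "dist_lattice (x - y) \<le> norm ((x - y) - (x - y))"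
          unfolding coset_eq_iff by (rule dist_lattice_le)
        then show ?thesis
          using s_pos by (simp only: True) simp
      next
        case False
        then show ?thesis
          using S2_ge[OF False] norm_pos[OF False] by (simp add: s divide_le_eq)
      qed
    qed (use s_pos in auto)
    then show ?thesis
      by (simp add: dist s)
  qed
qed

end

theorem theorem5p1:
  fixes L :: "(real ^ 'n) set"
  assumes "is_lattice L"
  shows "least_distortion TYPE('h::complex_hilbert) L \<ge>
           ereal (pi * shortest_length (dual_lattice L) * covering_radius L / sqrt (real CARD('n)))"
proof -
  obtain B where B: "independent B" "span B = UNIV"
    and L: "L = range (\<lambda>c :: real ^ 'n \<Rightarrow> int. \<Sum>b\<in>B. of_int (c b) *\<^sub>R b)"
    using assms unfolding is_lattice_def by blast
  interpret lattice_basis B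
    using B by unfold_locales
  have "L = range comb"
    unfolding L comb_def ..
  then show ?thesis
    unfolding least_distortion_def by (auto intro!: Inf_greatest distortion_ge)
qed

end
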